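(* Let $n\ge 1$ be an integer (of arbitrary parity) and set $k=\lfloor n/2\rfloor$. Then $$P_{\mathrm{TSASM}}=P_{\mathrm{ASM}}\cap P_{\mathrm{TS}}\cap\{X\in\mathbb R^{n\times n}: x_{i,k+1}=x_{k+1,i}=(-1)^{i+1}\ \text{for all } i\in[n]\}=P_{\mathrm{VSASM}}\cap P_{\mathrm{DS}}.$$
   Context: $[n]=\{1,\dots,n\}$. An $n\times n$ alternating sign matrix (ASM) is an $n\times n$ matrix with entries in $\{0,1,-1\}$ such that in each row and each column the non-zero entries alternate in sign and the first and last non-zero entries are $1$ (so every row and column sums to $1$). $P_{\mathrm{ASM}}\subseteq\mathbb R^{n\times n}$ is the convex hull of all $n\times n$ ASMs. $P_{\mathrm{VS}}=\{X\in\mathbb R^{n\times n}: x_{i,j}=x_{i,n+1-j}\ \forall i,j\in[n]\}$, $P_{\mathrm{DS}}=\{X\in\mathbb R^{n\times n}: x_{i,j}=x_{j,i}\ \forall i,j\in[n]\}$, and $P_{\mathrm{TS}}=P_{\mathrm{VS}}\cap P_{\mathrm{DS}}$ (the matrices invariant under all symmetries of the square). A VSASM is an $n\times n$ ASM lying in $P_{\mathrm{VS}}$, and a TSASM (totally symmetric ASM) is an $n\times n$ ASM lying in $P_{\mathrm{TS}}$. $P_{\mathrm{VSASM}}$ and $P_{\mathrm{TSASM}}$ are the convex hulls in $\mathbb R^{n\times n}$ of all $n\times n$ VSASMs and TSASMs, respectively (empty if there are none). *)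

theory Defs
  imports "HOL-Analysis.Analysis"
begin

text \<open>
  The space of real \<open>n \<times> n\<close> matrices is \<^typ>\<open>real^'n^'n\<close> with \<open>n = CARD('n)\<close>. The index type
  is linearly ordered, and \<open>idx i\<close> is its \<open>i\<close>-th smallest element (counting from 1), so that
  \<open>entry X i j\<close> is the matrix entry \<open>x\<^sub>i\<^sub>,\<^sub>j\<close>. Both are meaningful only for indices in
  \<open>{1..CARD('n)}\<close>.
\<close>

type_synonym 'n sq_matrix = "((real, 'n) vec, 'n) vec"

definition idx :: "nat \<Rightarrow> 'n::{finite,linorder}" where
  "idx i = sorted_list_of_set (UNIV :: 'n set) ! (i - 1)"

lemma bij_betw_idx: "bij_betw (idx :: nat \<Rightarrow> 'n::{finite,linorder}) {1..CARD('n)} UNIV"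
proof -
  have "bij_betw ((!) (sorted_list_of_set (UNIV :: 'n set))) {..<CARD('n)} UNIV"
    by (rule bij_betw_nth) auto
  moreover have "bij_betw (\<lambda>i. i - 1) {1..CARD('n)} {..<CARD('n)}"
    by (rule bij_betw_byWitness[where f' = Suc]) auto
  ultimately have "bij_betw ((!) (sorted_list_of_set (UNIV :: 'n set)) \<circ> (\<lambda>i. i - 1))
      {1..CARD('n)} UNIV"
    by (rule bij_betw_trans[rotated])
  then show ?thesis
    by (simp add: idx_def[abs_def] comp_def)
qed

lemma strict_mono_on_idx:
  "strict_mono_on {1..CARD('n)} (idx :: nat \<Rightarrow> 'n::{finite,linorder})"
  unfolding idx_def
  by (intro strict_mono_onI sorted_wrt_nth_less[of "(<)"]) auto

definition entry :: "'n::{finite,linorder} sq_matrix \<Rightarrow> nat \<Rightarrow> nat \<Rightarrow> real" where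
  "entry X i j = X $ idx i $ idx j"

definition nonzero_entries :: "nat \<Rightarrow> (nat \<Rightarrow> real) \<Rightarrow> real list" where
  "nonzero_entries n a = filter (\<lambda>x. x \<noteq> 0) (map a [1..<n + 1])"

definition alternating_line :: "nat \<Rightarrow> (nat \<Rightarrow> real) \<Rightarrow> bool" where
  "alternating_line n a \<longleftrightarrow>
     nonzero_entries n a \<noteq> [] \<and>
     hd (nonzero_entries n a) = 1 \<and>
     last (nonzero_entries n a) = 1 \<and>
     successively (\<lambda>x y. sgn y = - sgn x) (nonzero_entries n a)"

definition is_ASM :: "'n::{finite,linorder} sq_matrix \<Rightarrow> bool" where
  "is_ASM X \<longleftrightarrow>
     (\<forall>i\<in>{1..CARD('n)}. \<forall>j\<in>{1..CARD('n)}. entry X i j \<in> {0, 1, -1}) \<and>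
     (\<forall>i\<in>{1..CARD('n)}. alternating_line CARD('n) (\<lambda>j. entry X i j)) \<and>
     (\<forall>j\<in>{1..CARD('n)}. alternating_line CARD('n) (\<lambda>i. entry X i j))"

definition P_VS :: "'n::{finite,linorder} sq_matrix set" where
  "P_VS = {X. \<forall>i\<in>{1..CARD('n)}. \<forall>j\<in>{1..CARD('n)}.
     entry X i j = entry X i (CARD('n) + 1 - j)}"

definition P_DS :: "'n::{finite,linorder} sq_matrix set" where
  "P_DS = {X. \<forall>i\<in>{1..CARD('n)}. \<forall>j\<in>{1..CARD('n)}. entry X i j = entry X j i}"

definition P_TS :: "'n::{finite,linorder} sq_matrix set" where
  "P_TS = P_VS \<inter> P_DS"

definition is_VSASM :: "'n::{finite,linorder} sq_matrix \<Rightarrow> bool" where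
  "is_VSASM X \<longleftrightarrow> is_ASM X \<and> X \<in> P_VS"

definition is_TSASM :: "'n::{finite,linorder} sq_matrix \<Rightarrow> bool" where
  "is_TSASM X \<longleftrightarrow> is_ASM X \<and> X \<in> P_TS"

definition P_ASM :: "'n::{finite,linorder} sq_matrix set" where
  "P_ASM = convex hull {X. is_ASM X}"

definition P_VSASM :: "'n::{finite,linorder} sq_matrix set" where
  "P_VSASM = convex hull {X. is_VSASM X}"

definition P_TSASM :: "'n::{finite,linorder} sq_matrix set" where
  "P_TSASM = convex hull {X. is_TSASM X}"

end

theory Submission
  imports Defs
begin

text \<open>
  Let \<open>n = 2k + 1\<close>; for even \<open>n\<close> all three sets are empty, because the first row of a vertically
  symmetric matrix would have two equal middle entries. Once the middle row and column are fixed,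
  a totally symmetric matrix is determined by the corner sums \<open>c\<^sub>i\<^sub>j = c\<^sub>j\<^sub>i\<close> of its upper left
  \<open>k \<times> k\<close> quadrant, and the conditions on prefix sums become \<open>0 \<le> c\<^sub>i\<^sub>j - c\<^sub>i\<^sub>-\<^sub>1\<^sub>,\<^sub>j \<le> 1\<close> with
  integral boundary values \<open>c\<^sub>i\<^sub>k\<close>. In such a system of difference constraints with integral bounds
  the extreme points have integral coordinates, so by Krein--Milman the polytope is the convex hull
  of its integral points, which are the TSASMs.
\<close>

section \<open>Alternating lines and prefix sums\<close>

lemma nonzero_entries_0 [simp]: "nonzero_entries 0 a = []"
  by (simp add: nonzero_entries_def)

lemma nonzero_entries_Suc:
  "nonzero_entries (Suc n) a =
     nonzero_entries n a @ (if a (Suc n) = 0 then [] else [a (Suc n)])"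
  by (simp add: nonzero_entries_def)

text \<open>The induction carries the last nonzero entry along: a prefix sum of 1 means that it was
  1, so only 0 or -1 may follow, while a sum of 0 leaves only 0 or 1. The head condition is guarded
  because a prefix may consist of zeros.\<close>

lemma alternating_prefix_sums:
  fixes a :: "nat \<Rightarrow> real"
  assumes "\<And>j. j \<in> {1..n} \<Longrightarrow> a j \<in> {0, 1, -1}"
  shows "(successively (\<lambda>x y. sgn y = - sgn x) (nonzero_entries n a) \<and>
            (nonzero_entries n a \<noteq> [] \<longrightarrow> hd (nonzero_entries n a) = 1) \<longleftrightarrow>
          (\<forall>m\<le>n. (\<Sum>j=1..m. a j) \<in> {0, 1})) \<and>
         ((\<forall>m\<le>n. (\<Sum>j=1..m. a j) \<in> {0, 1}) \<longrightarrow>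
           (if (\<Sum>j=1..n. a j) = 1 then nonzero_entries n a \<noteq> [] \<and> last (nonzero_entries n a) = 1
            else nonzero_entries n a = [] \<or> last (nonzero_entries n a) = -1))"
  using assms
proof (induction n)
  case 0
  then show ?case by simp
next
  case (Suc n)
  let ?L = "nonzero_entries n a" and ?s = "\<Sum>j=1..n. a j"
  have IH: "(successively (\<lambda>x y. sgn y = - sgn x) ?L \<and> (?L \<noteq> [] \<longrightarrow> hd ?L = 1) \<longleftrightarrow>
          (\<forall>m\<le>n. (\<Sum>j=1..m. a j) \<in> {0, 1})) \<and>
         ((\<forall>m\<le>n. (\<Sum>j=1..m. a j) \<in> {0, 1}) \<longrightarrow>
           (if ?s = 1 then ?L \<noteq> [] \<and> last ?L = 1 else ?L = [] \<or> last ?L = -1))"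
    using Suc by simp
  have split: "(\<forall>m\<le>Suc n. P m) \<longleftrightarrow> (\<forall>m\<le>n. P m) \<and> P (Suc n)" for P
    by (metis le_Suc_eq)
  have s: "(\<Sum>j=1..Suc n. a j) = ?s + a (Suc n)" by simp
  have s01: "?s \<in> {0, 1}" if "\<forall>m\<le>n. (\<Sum>j=1..m. a j) \<in> {0, 1}"
    using that by blast
  have a: "a (Suc n) \<in> {0, 1, -1}" using Suc.prems by simp
  show ?case
  proof (cases "\<forall>m\<le>n. (\<Sum>j=1..m. a j) \<in> {0, 1}")
    case False
    then show ?thesis
      using IH unfolding split s nonzero_entries_Suc
      by (auto simp: successively_append_iff)
  next
    case True
    then show ?thesis
      using IH s01[OF True] a unfolding split s nonzero_entries_Suc
      by (cases "?L = []") (auto simp: successively_append_iff split: if_splits)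
  qed
qed

text \<open>This replaces sign alternation by partial sums, which a system of linear inequalities
  with integral solutions can control.\<close>

lemma alternating_line_iff:
  fixes a :: "nat \<Rightarrow> real"
  assumes "\<And>j. j \<in> {1..n} \<Longrightarrow> a j \<in> {0, 1, -1}"
  shows "alternating_line n a \<longleftrightarrow>
    (\<forall>m\<le>n. (\<Sum>j=1..m. a j) \<in> {0, 1}) \<and> (\<Sum>j=1..n. a j) = 1"
  using alternating_prefix_sums[of n a, OF assms]
  by (auto simp: alternating_line_def split: if_splits)

lemma diff_prefix_sums:
  fixes a :: "nat \<Rightarrow> real"
  assumes "1 \<le> j"
  shows "a j = (\<Sum>b=1..j. a b) - (\<Sum>b=1..j - 1. a b)"
  using assms by (cases j) auto

lemma entries_of_prefix_sums:
  fixes a :: "nat \<Rightarrow> real"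
  assumes "\<And>m. m \<le> n \<Longrightarrow> (\<Sum>j=1..m. a j) \<in> {0, 1}" "j \<in> {1..n}"
  shows "a j \<in> {0, 1, -1}"
proof -
  have "j \<le> n" "j - 1 \<le> n" "1 \<le> j" using assms(2) by auto
  then show ?thesis
    using assms(1)[of j] assms(1)[of "j - 1"] diff_prefix_sums[of j a] by auto
qed

lemma prefix_sum_cong:
  fixes a b :: "nat \<Rightarrow> real"
  assumes "m \<le> n" "\<And>j. j \<in> {1..n} \<Longrightarrow> a j = b j"
  shows "(\<Sum>j=1..m. a j) = (\<Sum>j=1..m. b j)"
proof (rule sum.cong[OF refl])
  show "a j = b j" if "j \<in> {1..m}" for j
    using that assms(1) by (intro assms(2)) simp
qed

lemma sum_palindrome:
  fixes a :: "nat \<Rightarrow> real"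
  assumes "\<And>j. j \<in> {1..n} \<Longrightarrow> a j = a (n + 1 - j)" "m \<le> n"
  shows "(\<Sum>j=1..n. a j) = (\<Sum>j=1..m. a j) + (\<Sum>j=1..n - m. a j)"
proof -
  have "(\<Sum>j=1..n. a j) = (\<Sum>j=1..m. a j) + (\<Sum>j=m+1..n. a j)"
    using assms(2) by (metis le_add1 sum.ub_add_nat add.commute le_add_diff_inverse)
  also have "(\<Sum>j=m+1..n. a j) = (\<Sum>j=1..n - m. a j)"
    by (rule sum.reindex_bij_witness[of _ "\<lambda>j. n + 1 - j" "\<lambda>j. n + 1 - j"])
      (use assms in auto)
  finally show ?thesis .
qed

lemma sum_palindrome_odd:
  fixes a :: "nat \<Rightarrow> real"
  assumes "\<And>j. j \<in> {1..2 * k + 1} \<Longrightarrow> a j = a (2 * k + 1 + 1 - j)"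
  shows "(\<Sum>j=1..2 * k + 1. a j) = 2 * (\<Sum>j=1..k. a j) + a (k + 1)"
  using sum_palindrome[of "2 * k + 1" a k, OF assms] by simp

section \<open>Entries and prefix sums of matrices\<close>

lemma entry_add [simp]: "entry (X + Y) i j = entry X i j + entry Y i j"
  and entry_diff [simp]: "entry (X - Y) i j = entry X i j - entry Y i j"
  and entry_scaleR [simp]: "entry (c *\<^sub>R X) i j = c * entry X i j"
  and entry_0 [simp]: "entry 0 i j = 0"
  by (simp_all add: entry_def)

lemma continuous_on_entry [continuous_intros]: "continuous_on S (\<lambda>X. entry X i j)"
  unfolding entry_def by (intro continuous_intros)

definition of_entries :: "(nat \<Rightarrow> nat \<Rightarrow> real) \<Rightarrow> 'n::{finite,linorder} sq_matrix" where
  "of_entries f = (\<chi> i j. f (the_inv_into {1..CARD('n)} idx i) (the_inv_into {1..CARD('n)} idx j))"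

lemma entry_of_entries [simp]:
  assumes "i \<in> {1..CARD('n)}" "j \<in> {1..CARD('n)}"
  shows "entry (of_entries f :: 'n::{finite,linorder} sq_matrix) i j = f i j"
proof -
  have "inj_on (idx :: nat \<Rightarrow> 'n) {1..CARD('n)}"
    using bij_betw_idx bij_betw_def by blast
  then show ?thesis
    using assms by (simp add: entry_def of_entries_def the_inv_into_f_f)
qed

definition row_sum :: "'n::{finite,linorder} sq_matrix \<Rightarrow> nat \<Rightarrow> nat \<Rightarrow> real" where
  "row_sum X i j = (\<Sum>b=1..j. entry X i b)"

lemma row_sum_add [simp]: "row_sum (X + Y) i j = row_sum X i j + row_sum Y i j"
  and row_sum_diff [simp]: "row_sum (X - Y) i j = row_sum X i j - row_sum Y i j"
  and row_sum_scaleR [simp]: "row_sum (c *\<^sub>R X) i j = c * row_sum X i j"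
  by (simp_all add: row_sum_def sum.distrib sum_subtractf sum_distrib_left)

lemma continuous_on_row_sum [continuous_intros]: "continuous_on S (\<lambda>X. row_sum X i j)"
  unfolding row_sum_def by (intro continuous_intros)

text \<open>Every component is reached because \<open>idx\<close> is onto; the norm is then at most
  the sum of the absolute values of all components.\<close>

lemma bounded_entries:
  fixes S :: "'n::{finite,linorder} sq_matrix set"
  assumes "\<And>X i j. X \<in> S \<Longrightarrow> i \<in> {1..CARD('n)} \<Longrightarrow> j \<in> {1..CARD('n)} \<Longrightarrow> \<bar>entry X i j\<bar> \<le> B"
  shows "bounded S"
proof -
  have comp: "\<bar>X $ i $ j\<bar> \<le> B" if "X \<in> S" for X :: "'n sq_matrix" and i j
  proof -
    obtain a b where "a \<in> {1..CARD('n)}" "b \<in> {1..CARD('n)}" "i = idx a" "j = idx b"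
      using bij_betw_idx[where 'n = 'n] unfolding bij_betw_def by (metis UNIV_I imageE)
    then show ?thesis using assms[OF that] by (simp add: entry_def)
  qed
  have "norm X \<le> (\<Sum>i\<in>(UNIV::'n set). \<Sum>j\<in>(UNIV::'n set). B)" if "X \<in> S" for X
  proof -
    have "norm X \<le> (\<Sum>i\<in>UNIV. norm (X $ i))"
      unfolding norm_vec_def by (rule L2_set_le_sum) simp
    also have "\<dots> \<le> (\<Sum>i\<in>UNIV. \<Sum>j\<in>UNIV. \<bar>X $ i $ j\<bar>)"
      by (intro sum_mono norm_le_l1_cart)
    also have "\<dots> \<le> (\<Sum>i\<in>(UNIV::'n set). \<Sum>j\<in>(UNIV::'n set). B)"
      by (intro sum_mono comp that)
    finally show ?thesis .
  qed
  then show ?thesis unfolding bounded_iff by blast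
qed

section \<open>Linear constraints on the ASM polytope\<close>

lemma row_sum_ASM:
  fixes X :: "'n::{finite,linorder} sq_matrix"
  assumes "is_ASM X" "i \<in> {1..CARD('n)}"
  shows "j \<le> CARD('n) \<Longrightarrow> row_sum X i j \<in> {0, 1}" "row_sum X i CARD('n) = 1"
  using assms alternating_line_iff[of "CARD('n)" "\<lambda>j. entry X i j"]
  unfolding row_sum_def is_ASM_def by blast+

lemma convex_P_DS: "convex P_DS"
  and convex_P_VS: "convex P_VS"
  by (auto simp: convex_def P_DS_def P_VS_def)

text \<open>The constraints are linear and hold at every ASM, so they cut out a convex set
  containing the hull.\<close>

lemma row_sum_P_ASM:
  fixes X :: "'n::{finite,linorder} sq_matrix"
  assumes "X \<in> P_ASM" "i \<in> {1..CARD('n)}" "j \<le> CARD('n)"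
  shows "0 \<le> row_sum X i j" "row_sum X i j \<le> 1" "row_sum X i CARD('n) = 1"
proof -
  let ?C = "{X :: 'n sq_matrix. 0 \<le> row_sum X i j \<and> row_sum X i j \<le> 1 \<and> row_sum X i CARD('n) = 1}"
  have "convex ?C"
    by (auto simp: convex_def intro!: convex_bound_le)
  moreover have "{X. is_ASM X} \<subseteq> ?C"
    using row_sum_ASM[OF _ assms(2)] assms(3) by fastforce
  ultimately have "P_ASM \<subseteq> ?C"
    unfolding P_ASM_def by (rule hull_minimal[rotated])
  then show "0 \<le> row_sum X i j" "row_sum X i j \<le> 1" "row_sum X i CARD('n) = 1"
    using assms(1) by auto
qed

section \<open>The forced middle column and the parity of n\<close>

definition middle_cross :: "nat \<Rightarrow> 'n::{finite,linorder} sq_matrix set" where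
  "middle_cross k = {X. \<forall>i\<in>{1..CARD('n)}. entry X i (k + 1) = (-1) ^ (i + 1) \<and>
                                  entry X (k + 1) i = (-1) ^ (i + 1)}"

lemma convex_middle_column:
  "convex {X :: 'n::{finite,linorder} sq_matrix. \<forall>i\<in>{1..CARD('n)}. entry X i (k + 1) = (-1) ^ (i + 1)}"
proof (rule convexI)
  fix X Y :: "'n sq_matrix" and u v :: real
  assume XY: "X \<in> {X. \<forall>i\<in>{1..CARD('n)}. entry X i (k + 1) = (-1) ^ (i + 1)}"
      "Y \<in> {X. \<forall>i\<in>{1..CARD('n)}. entry X i (k + 1) = (-1) ^ (i + 1)}"
    and uv: "u + v = 1"
  have v: "v = 1 - u" using uv by simp
  show "u *\<^sub>R X + v *\<^sub>R Y \<in> {X. \<forall>i\<in>{1..CARD('n)}. entry X i (k + 1) = (-1) ^ (i + 1)}"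
    using XY by (simp add: v algebra_simps)
qed

text \<open>A palindromic row of odd length sums to twice its left half plus its middle entry. Total
  1 and a left half of 0 or 1 make that entry nonzero, so the middle column alternates without
  zeros, starting with 1.\<close>

lemma VSASM_middle_column:
  fixes X :: "'n::{finite,linorder} sq_matrix"
  assumes "is_VSASM X" "k = CARD('n) div 2" "i \<in> {1..CARD('n)}"
  shows "odd CARD('n)" "entry X i (k + 1) = (-1) ^ (i + 1)"
proof -
  have asm: "is_ASM X" and vs: "X \<in> P_VS"
    using assms(1) by (auto simp: is_VSASM_def)
  have pal: "entry X i j = entry X i (CARD('n) + 1 - j)"
    if "i \<in> {1..CARD('n)}" "j \<in> {1..CARD('n)}" for i j
    using vs that by (auto simp: P_VS_def)
  show odd: "odd CARD('n)"
  \<comment> \<open>For even n a row sum is twice a half sum from {0, 1}, hence never 1.\<close>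
  proof
    assume "even CARD('n)"
    then have n: "CARD('n) = 2 * k" using assms(2) by simp
    have "row_sum X i CARD('n) = row_sum X i k + row_sum X i (CARD('n) - k)"
      unfolding row_sum_def by (rule sum_palindrome) (use pal assms(3) n in auto)
    also have "CARD('n) - k = k" using n by simp
    finally show False
      using row_sum_ASM(2)[OF asm assms(3)] row_sum_ASM(1)[OF asm assms(3), of k] n by auto
  qed
  then have n: "CARD('n) = 2 * k + 1" using assms(2) by presburger
  have mid: "entry X i (k + 1) \<in> {1, -1}" if "i \<in> {1..CARD('n)}" for i
  proof -
    have "row_sum X i CARD('n) = 2 * row_sum X i k + entry X i (k + 1)"
      unfolding row_sum_def n by (rule sum_palindrome_odd) (use pal[OF that] n in auto)
    then show ?thesis
      using row_sum_ASM(2)[OF asm that] row_sum_ASM(1)[OF asm that, of k] n by auto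
  qed
  let ?s = "\<lambda>m. \<Sum>a=1..m. entry X a (k + 1)"
  have s: "?s m \<in> {0, 1}" if "m \<le> CARD('n)" for m
    using asm that alternating_line_iff[of "CARD('n)" "\<lambda>i. entry X i (k + 1)"] n
    unfolding is_ASM_def by auto
  \<comment> \<open>A step of 1 or -1 that stays inside {0, 1} must flip the value, and the empty
    sum is 0.\<close>
  have "?s m = (if even m then 0 else 1)" if "m \<le> CARD('n)" for m
    using that
  proof (induction m)
    case (Suc m)
    then show ?case using mid[of "Suc m"] s[of "Suc m"] by (auto split: if_splits)
  qed simp
  from this[of i] this[of "i - 1"] show "entry X i (k + 1) = (-1) ^ (i + 1)"
    using assms(3) diff_prefix_sums[of i "\<lambda>a. entry X a (k + 1)"] by (auto split: if_splits)
qed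

text \<open>For even n, columns k and k + 1 mirror each other, so row 1 would carry two adjacent
  entries 1, forcing a prefix sum of at least 2.\<close>

lemma odd_card_of_middle_cross:
  fixes X :: "'n::{finite,linorder} sq_matrix"
  assumes "X \<in> P_ASM \<inter> P_TS \<inter> middle_cross k" "k = CARD('n) div 2"
  shows "odd CARD('n)"
proof
  assume "even CARD('n)"
  then have n: "CARD('n) = 2 * k" using assms(2) by simp
  then have k: "1 \<le> k" using zero_less_card_finite[where 'a = 'n] by linarith
  have "\<forall>i\<in>{1..CARD('n)}. entry X i (k + 1) = (-1) ^ (i + 1)"
    using assms(1) unfolding middle_cross_def by blast
  from bspec[OF this, of 1] have one: "entry X 1 (k + 1) = 1" using n k by simp
  have "\<forall>i\<in>{1..CARD('n)}. \<forall>j\<in>{1..CARD('n)}. entry X i j = entry X i (CARD('n) + 1 - j)"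
    using assms(1) unfolding P_TS_def P_VS_def by blast
  from bspec[OF bspec[OF this, of 1], of k] have "entry X 1 k = 1" using n k one by simp
  moreover note one
  moreover have "row_sum X 1 (k + 1) = row_sum X 1 (k - 1) + entry X 1 k + entry X 1 (k + 1)"
    using k unfolding row_sum_def by (cases k) auto
  moreover have "k - 1 \<le> CARD('n)" "k + 1 \<le> CARD('n)" using n k by auto
  ultimately show False
    using row_sum_P_ASM(1)[of X 1 "k - 1"] row_sum_P_ASM(2)[of X 1 "k + 1"] assms(1) k n by auto
qed

section \<open>The quadrant polytope\<close>

text \<open>
  The row sums over the left half are forced by the middle column and the palindromic rows;
  the bounds outside the upper left quadrant follow by symmetry.
\<close>

definition quadrant_polytope :: "nat \<Rightarrow> 'n::{finite,linorder} sq_matrix set" where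
  "quadrant_polytope k = {X. X \<in> P_TS \<and>
     (\<forall>i\<in>{1..CARD('n)}. entry X i (k + 1) = (-1) ^ (i + 1)) \<and>
     (\<forall>i\<in>{1..k}. 2 * row_sum X i k = 1 - (-1) ^ (i + 1)) \<and>
     (\<forall>i\<in>{1..k}. \<forall>j\<in>{1..k}. 0 \<le> row_sum X i j \<and> row_sum X i j \<le> 1)}"

lemma middle_cross_subset_quadrant_polytope:
  assumes n: "CARD('n::{finite,linorder}) = 2 * k + 1"
  shows "P_ASM \<inter> P_TS \<inter> middle_cross k \<subseteq> (quadrant_polytope k :: 'n sq_matrix set)"
proof
  fix X :: "'n sq_matrix"
  assume X: "X \<in> P_ASM \<inter> P_TS \<inter> middle_cross k"
  have "2 * row_sum X i k = 1 - (-1) ^ (i + 1)" if i: "i \<in> {1..k}" for i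
  proof -
    \<comment> \<open>The row total 1 and the prescribed middle entry determine the left half
      sum.\<close>
    have "row_sum X i CARD('n) = 2 * row_sum X i k + entry X i (k + 1)"
      unfolding row_sum_def n
      by (rule sum_palindrome_odd) (use X i n in \<open>auto simp: P_TS_def P_VS_def\<close>)
    moreover have "row_sum X i CARD('n) = 1"
      using X i n row_sum_P_ASM(3)[of X i 0] by auto
    moreover have "entry X i (k + 1) = (-1) ^ (i + 1)"
      using X i n by (auto simp: middle_cross_def)
    ultimately show ?thesis by simp
  qed
  then show "X \<in> quadrant_polytope k"
    using X row_sum_P_ASM(1,2)[of X] n
    by (auto simp: quadrant_polytope_def middle_cross_def)
qed

text \<open>For n = 2k + 1 the reflection is \<open>i\<close> to \<open>2 * k + 2 - i\<close>; the
  smaller index represents the pair, and the middle k + 1 is fixed.\<close>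

definition fold_index :: "nat \<Rightarrow> nat \<Rightarrow> nat" where
  "fold_index k i = min i (2 * k + 2 - i)"

text \<open>Only column reflection and transposition are given; a row is folded by transposing,
  folding the column and transposing back.\<close>

lemma entry_fold_index:
  fixes X :: "'n::{finite,linorder} sq_matrix"
  assumes n: "CARD('n) = 2 * k + 1" and X: "X \<in> P_TS"
    and ij: "i \<in> {1..CARD('n)}" "j \<in> {1..CARD('n)}"
  shows "entry X i j = entry X (fold_index k i) (fold_index k j)"
proof -
  have vs: "entry X a b = entry X a (2 * k + 2 - b)"
    if "a \<in> {1..CARD('n)}" "b \<in> {1..CARD('n)}" for a b
    using X that n by (auto simp: P_TS_def P_VS_def)
  have ds: "entry X a b = entry X b a" if "a \<in> {1..CARD('n)}" "b \<in> {1..CARD('n)}" for a b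
    using X that by (auto simp: P_TS_def P_DS_def)
  have fold: "entry X a b = entry X a (fold_index k b)"
    if "a \<in> {1..CARD('n)}" "b \<in> {1..CARD('n)}" for a b
    using vs[OF that] by (auto simp: fold_index_def min_def)
  have j: "fold_index k j \<in> {1..CARD('n)}" and i: "fold_index k i \<in> {1..CARD('n)}"
    using ij n by (auto simp: fold_index_def)
  have "entry X i j = entry X i (fold_index k j)" by (rule fold[OF ij])
  also have "\<dots> = entry X (fold_index k j) i" by (rule ds[OF ij(1) j])
  also have "\<dots> = entry X (fold_index k j) (fold_index k i)" by (rule fold[OF j ij(1)])
  also have "\<dots> = entry X (fold_index k i) (fold_index k j)" by (rule ds[OF j i])
  finally show ?thesis .
qed

lemma fold_index_cases:
  assumes "i \<in> {1..2 * k + 1}"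
  shows "fold_index k i \<in> {1..k} \<or> fold_index k i = k + 1"
  using assms by (auto simp: fold_index_def)

text \<open>Closedness is clear from the linear description. For boundedness, a quadrant entry is a
  difference of two prefix sums in [0, 1], the middle cross has entries 1 and -1, and folding
  reaches every other position.\<close>

lemma compact_quadrant_polytope:
  assumes n: "CARD('n::{finite,linorder}) = 2 * k + 1"
  shows "compact (quadrant_polytope k :: 'n sq_matrix set)"
proof -
  have "closed (quadrant_polytope k :: 'n sq_matrix set)"
    unfolding quadrant_polytope_def P_TS_def P_VS_def P_DS_def Ball_def Int_iff mem_Collect_eq
    by (intro closed_Collect_conj closed_Collect_all closed_Collect_imp closed_Collect_eq
        closed_Collect_le continuous_on_entry continuous_on_row_sum continuous_on_const
        continuous_on_mult open_Collect_const)
  moreover have "bounded (quadrant_polytope k :: 'n sq_matrix set)"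
  proof (rule bounded_entries[where B = 1])
    fix X :: "'n sq_matrix" and i j
    assume X: "X \<in> quadrant_polytope k" and ij: "i \<in> {1..CARD('n)}" "j \<in> {1..CARD('n)}"
    have "\<bar>entry X a b\<bar> \<le> 1" if "a \<in> {1..k}" "b \<in> {1..k}" for a b
    proof -
      have "entry X a b = row_sum X a b - row_sum X a (b - 1)"
        unfolding row_sum_def by (rule diff_prefix_sums) (use that in auto)
      \<comment> \<open>The polytope bounds columns from 1 on; column 0, which occurs for b = 1, is
        the empty sum.\<close>
      moreover have "0 \<le> row_sum X a c \<and> row_sum X a c \<le> 1" if "c \<le> k" for c
        using X that \<open>a \<in> {1..k}\<close>
        by (cases "c = 0") (auto simp: quadrant_polytope_def row_sum_def[of _ _ 0])
      ultimately show ?thesis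
        using that by (smt (verit) atLeastAtMost_iff diff_le_self le_trans)
    qed
    moreover have mid: "\<bar>entry X a (k + 1)\<bar> \<le> 1" if "a \<in> {1..CARD('n)}" for a
      using X that by (auto simp: quadrant_polytope_def power_abs)
    moreover have "\<bar>entry X (k + 1) a\<bar> \<le> 1" if "a \<in> {1..CARD('n)}" for a
    proof -
      have "entry X (k + 1) a = entry X a (k + 1)"
        using X that n by (auto simp: quadrant_polytope_def P_TS_def P_DS_def)
      then show ?thesis using mid[OF that] by simp
    qed
    ultimately have "\<bar>entry X (fold_index k i) (fold_index k j)\<bar> \<le> 1"
      using fold_index_cases[of i k] fold_index_cases[of j k] ij n by auto
    then show "\<bar>entry X i j\<bar> \<le> 1"
      using entry_fold_index[OF n _ ij, of X] X by (auto simp: quadrant_polytope_def)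
  qed
  ultimately show ?thesis by (simp add: compact_eq_bounded_closed)
qed

lemma convex_quadrant_polytope: "convex (quadrant_polytope k)"
proof (rule convexI)
  fix X Y :: "'n::{finite,linorder} sq_matrix" and u v :: real
  assume XY: "X \<in> quadrant_polytope k" "Y \<in> quadrant_polytope k"
    and uv: "0 \<le> u" "0 \<le> v" "u + v = 1"
  have v: "v = 1 - u" using uv by simp
  have "u *\<^sub>R X + v *\<^sub>R Y \<in> P_TS"
    using XY uv convex_Int[OF convex_P_VS convex_P_DS]
    by (auto simp: quadrant_polytope_def P_TS_def convex_def)
  moreover have "entry (u *\<^sub>R X + v *\<^sub>R Y) i (k + 1) = (-1) ^ (i + 1)" if "i \<in> {1..CARD('n)}" for i
    using XY that by (simp add: quadrant_polytope_def v algebra_simps)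
  moreover have "2 * row_sum (u *\<^sub>R X + v *\<^sub>R Y) i k = 1 - (-1) ^ (i + 1)" if "i \<in> {1..k}" for i
  proof -
    have "2 * row_sum (u *\<^sub>R X + v *\<^sub>R Y) i k = u * (2 * row_sum X i k) + v * (2 * row_sum Y i k)"
      by (simp add: algebra_simps)
    also have "\<dots> = 1 - (-1) ^ (i + 1)"
      using XY that by (simp add: quadrant_polytope_def v algebra_simps)
    finally show ?thesis .
  qed
  moreover have "0 \<le> row_sum (u *\<^sub>R X + v *\<^sub>R Y) i j \<and> row_sum (u *\<^sub>R X + v *\<^sub>R Y) i j \<le> 1"
    if "i \<in> {1..k}" "j \<in> {1..k}" for i j
    using XY that uv by (auto simp: quadrant_polytope_def intro!: convex_bound_le)
  ultimately show "u *\<^sub>R X + v *\<^sub>R Y \<in> quadrant_polytope k"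
    by (auto simp: quadrant_polytope_def)
qed

section \<open>Extreme points\<close>

text \<open>Integrality and the bounds settle the left half of the upper rows; the palindrome gives
  their right half, folding the lower rows, and transposition the columns.\<close>

lemma integral_quadrant_polytope_TSASM:
  fixes X :: "'n::{finite,linorder} sq_matrix"
  assumes n: "CARD('n) = 2 * k + 1" and X: "X \<in> quadrant_polytope k"
    and int: "\<And>i j. i \<in> {1..k} \<Longrightarrow> j \<in> {1..k} \<Longrightarrow> row_sum X i j \<in> \<int>"
  shows "is_TSASM X"
proof -
  have TS: "X \<in> P_TS" and ds: "\<And>i j. i \<in> {1..CARD('n)} \<Longrightarrow> j \<in> {1..CARD('n)} \<Longrightarrow> entry X i j = entry X j i"
    and vs: "\<And>i j. i \<in> {1..CARD('n)} \<Longrightarrow> j \<in> {1..CARD('n)} \<Longrightarrow> entry X i j = entry X i (CARD('n) + 1 - j)"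
    and mid: "\<And>i. i \<in> {1..CARD('n)} \<Longrightarrow> entry X i (k + 1) = (-1) ^ (i + 1)"
    and half: "\<And>i. i \<in> {1..k} \<Longrightarrow> 2 * row_sum X i k = 1 - (-1) ^ (i + 1)"
    and bnd: "\<And>i j. i \<in> {1..k} \<Longrightarrow> j \<in> {1..k} \<Longrightarrow> 0 \<le> row_sum X i j \<and> row_sum X i j \<le> 1"
    using X unfolding quadrant_polytope_def P_TS_def P_DS_def P_VS_def by blast+
  have upper: "row_sum X i m \<in> {0, 1} \<and> row_sum X i CARD('n) = 1"
    if i: "i \<in> {1..k}" and m: "m \<le> CARD('n)" for i m
  proof -
    have iN: "i \<in> {1..CARD('n)}" using i n by auto
    have "row_sum X i CARD('n) = 2 * row_sum X i k + entry X i (k + 1)"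
      unfolding row_sum_def n by (rule sum_palindrome_odd) (rule vs[OF iN, unfolded n])
    then have total: "row_sum X i CARD('n) = 1"
      unfolding half[OF i] mid[OF iN] by simp
    have left: "row_sum X i m \<in> {0, 1}" if "m \<le> k" for m
    proof (cases "m = 0")
      case False
      then have m: "m \<in> {1..k}" using that by simp
      obtain z where z: "row_sum X i m = of_int z"
        using int[OF i m] by (rule Ints_cases)
      then have "z = 0 \<or> z = 1" using bnd[OF i m] by auto
      with z show ?thesis by auto
    qed (simp add: row_sum_def)
    have "row_sum X i m \<in> {0, 1}"
    proof (cases "m \<le> k")
      case False
      \<comment> \<open>For m > k the complementary length n - m is at most k, so the prefix sum is
        1 minus one already known.\<close>
      have "row_sum X i CARD('n) = row_sum X i m + row_sum X i (CARD('n) - m)"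
        unfolding row_sum_def by (rule sum_palindrome[OF _ m]) (rule vs[OF iN])
      then show ?thesis using left[of "CARD('n) - m"] total False n by auto
    qed (rule left)
    with total show ?thesis by simp
  qed
  \<comment> \<open>The middle row is the transposed middle column 1, -1, 1, ...; its total is 1
    because n is odd.\<close>
  have middle: "row_sum X (k + 1) m = (if even m then 0 else 1)" if "m \<le> CARD('n)" for m
    using that
  proof (induction m)
    case (Suc m)
    have "entry X (k + 1) (Suc m) = (-1) ^ (Suc m + 1)"
      using mid[of "Suc m"] ds[of "k + 1" "Suc m"] Suc.prems n by simp
    then show ?case using Suc by (simp add: row_sum_def)
  qed (simp add: row_sum_def)
  have rows: "row_sum X i m \<in> {0, 1} \<and> row_sum X i CARD('n) = 1"
    if i: "i \<in> {1..CARD('n)}" and m: "m \<le> CARD('n)" for i m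
  proof -
    have fold: "fold_index k i \<in> {1..k} \<or> fold_index k i = k + 1"
      using fold_index_cases i n by simp
    \<comment> \<open>Folding is idempotent, so both entries fold to the same one.\<close>
    have "entry X i j = entry X (fold_index k i) j" if "j \<in> {1..CARD('n)}" for j
    proof -
      have "fold_index k i \<in> {1..CARD('n)}" "fold_index k (fold_index k i) = fold_index k i"
        using i n by (auto simp: fold_index_def)
      then show ?thesis
        using entry_fold_index[OF n TS i that] entry_fold_index[OF n TS _ that, of "fold_index k i"]
        by simp
    qed
    then have "row_sum X i l = row_sum X (fold_index k i) l" if "l \<le> CARD('n)" for l
      unfolding row_sum_def using that by (intro prefix_sum_cong) auto
    then show ?thesis
      using fold upper[of "fold_index k i" m] middle[of m] middle[of "CARD('n)"] m n
      by (cases "even m") auto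
  qed
  have entries: "entry X i j \<in> {0, 1, -1}" if "i \<in> {1..CARD('n)}" "j \<in> {1..CARD('n)}" for i j
    using entries_of_prefix_sums[OF _ that(2), of "\<lambda>j. entry X i j"] rows[OF that(1)]
    unfolding row_sum_def by blast
  have row_lines: "alternating_line CARD('n) (\<lambda>j. entry X i j)" if "i \<in> {1..CARD('n)}" for i
    using alternating_line_iff[of "CARD('n)" "\<lambda>j. entry X i j"] entries[OF that] rows[OF that]
    unfolding row_sum_def by blast
  have "alternating_line CARD('n) (\<lambda>i. entry X i j)" if j: "j \<in> {1..CARD('n)}" for j
  proof -
    have "map (\<lambda>i. entry X i j) [1..<CARD('n) + 1] = map (\<lambda>i. entry X j i) [1..<CARD('n) + 1]"
      using ds j by auto
    then show ?thesis
      using row_lines[OF j] unfolding alternating_line_def nonzero_entries_def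
      by (simp only: simp_thms)
  qed
  with entries row_lines TS show ?thesis
    by (simp add: is_TSASM_def is_ASM_def)
qed

section \<open>Corner sums and perturbation directions\<close>

lemma sum_diff_telescope:
  fixes f :: "nat \<Rightarrow> real"
  shows "(\<Sum>i=1..m. f i - f (i - 1)) = f m - f 0"
  by (induction m) auto

text \<open>In these coordinates the bounds on row sums are difference constraints, and diagonal
  symmetry becomes symmetry in i and j.\<close>

definition corner_sum :: "'n::{finite,linorder} sq_matrix \<Rightarrow> nat \<Rightarrow> nat \<Rightarrow> real" where
  "corner_sum X i j = (\<Sum>a=1..i. row_sum X a j)"

lemma corner_sum_0 [simp]: "corner_sum X 0 j = 0" "corner_sum X i 0 = 0"
  by (simp_all add: corner_sum_def row_sum_def)

lemma row_sum_eq_corner_sum: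
  "1 \<le> i \<Longrightarrow> row_sum X i j = corner_sum X i j - corner_sum X (i - 1) j"
  unfolding corner_sum_def by (rule diff_prefix_sums)

lemma corner_sum_commute:
  fixes X :: "'n::{finite,linorder} sq_matrix"
  assumes "X \<in> P_DS" "i \<le> CARD('n)" "j \<le> CARD('n)"
  shows "corner_sum X i j = corner_sum X j i"
proof -
  have "corner_sum X i j = (\<Sum>b=1..j. \<Sum>a=1..i. entry X a b)"
    unfolding corner_sum_def row_sum_def by (rule sum.swap)
  also have "\<dots> = corner_sum X j i"
    unfolding corner_sum_def row_sum_def
    using assms by (intro sum.cong) (auto simp: P_DS_def)
  finally show ?thesis .
qed

text \<open>The matrix whose corner sums in the upper left quadrant are \<open>h\<close>, extended by symmetry.\<close>

definition quadrant_matrix :: "nat \<Rightarrow> (nat \<Rightarrow> nat \<Rightarrow> real) \<Rightarrow> 'n::{finite,linorder} sq_matrix" where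
  "quadrant_matrix k h = of_entries (\<lambda>i j.
     let a = fold_index k i; b = fold_index k j in
       if a \<le> k \<and> b \<le> k
       then (h a b - h (a - 1) b) - (h a (b - 1) - h (a - 1) (b - 1)) else 0)"

context
  fixes k :: nat and h :: "nat \<Rightarrow> nat \<Rightarrow> real" and D :: "'n::{finite,linorder} sq_matrix"
  assumes n: "CARD('n) = 2 * k + 1"
    and sym: "\<And>i j. i \<le> k \<Longrightarrow> j \<le> k \<Longrightarrow> h i j = h j i"
    and zero: "\<And>i. i \<le> k \<Longrightarrow> h i 0 = 0"
    and D: "D = quadrant_matrix k h"
begin

text \<open>Vertical symmetry is built in by folding; the mixed second difference of a symmetric
  \<open>h\<close> is symmetric.\<close>

lemma quadrant_matrix_P_TS: "D \<in> P_TS"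
proof -
  have "entry D i j = entry D i (CARD('n) + 1 - j)"
    if "i \<in> {1..CARD('n)}" "j \<in> {1..CARD('n)}" for i j
  proof -
    have "fold_index k (CARD('n) + 1 - j) = fold_index k j" "CARD('n) + 1 - j \<in> {1..CARD('n)}"
      using that n by (auto simp: fold_index_def)
    then show ?thesis
      unfolding D quadrant_matrix_def using that by (simp only: entry_of_entries)
  qed
  then have "D \<in> P_VS" by (simp add: P_VS_def)
  moreover have "D \<in> P_DS"
    by (auto simp: P_DS_def D quadrant_matrix_def Let_def sym)
  ultimately show ?thesis by (simp add: P_TS_def)
qed

text \<open>Index k + 1 folds to itself and falls into the zero branch: a direction must not move
  the prescribed middle column.\<close>

lemma quadrant_matrix_middle: "i \<in> {1..CARD('n)} \<Longrightarrow> entry D i (k + 1) = 0"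
  using n by (auto simp: D quadrant_matrix_def fold_index_def Let_def)

text \<open>The mixed differences telescope along the row, and the boundary term at column 0
  vanishes by \<open>zero\<close>.\<close>

lemma row_sum_quadrant_matrix:
  assumes "i \<in> {1..k}" "j \<le> k"
  shows "row_sum D i j = h i j - h (i - 1) j"
proof -
  have "row_sum D i j = (\<Sum>b=1..j. (h i b - h (i - 1) b) - (h i (b - 1) - h (i - 1) (b - 1)))"
    unfolding row_sum_def using assms n
    by (intro sum.cong) (auto simp: D quadrant_matrix_def fold_index_def min_def Let_def)
  also have "\<dots> = h i j - h (i - 1) j"
    using sum_diff_telescope[of "\<lambda>b. h i b - h (i - 1) b" j]
      zero[of i] zero[of "i - 1"] assms by auto
  finally show ?thesis .
qed

end

text \<open>
  If some corner sum is fractional, all corner sums with the same fractional part can be shifted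
  together in both directions: a row sum changes only if it is itself fractional, hence not tight.
\<close>

lemma extreme_point_corner_sum_Ints:
  fixes X :: "'n::{finite,linorder} sq_matrix"
  assumes n: "CARD('n) = 2 * k + 1" and ext: "X extreme_point_of quadrant_polytope k"
    and pq: "p \<le> k" "q \<le> k"
  shows "corner_sum X p q \<in> \<int>"
proof (rule ccontr)
  assume frac: "corner_sum X p q \<notin> \<int>"
  have X: "X \<in> quadrant_polytope k"
    using ext by (simp add: extreme_point_of_def)
  \<comment> \<open>\<open>h\<close> is the indicator of the corner sums congruent to the chosen
    fractional one modulo 1.\<close>
  define h where "h i j = (if corner_sum X i j - corner_sum X p q \<in> \<int> then 1 else 0 :: real)" for i j
  define D :: "'n sq_matrix" where "D = quadrant_matrix k h"
  have DS: "X \<in> P_DS" using X by (simp add: quadrant_polytope_def P_TS_def)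
  have neg: "- corner_sum X p q \<notin> \<int>"
    using frac Ints_minus by fastforce
  have hsym: "h i j = h j i" if "i \<le> k" "j \<le> k" for i j
    using corner_sum_commute[OF DS] that n by (simp add: h_def)
  \<comment> \<open>Boundary corner sums are 0, hence integral and outside the fractional
    class.\<close>
  have h0: "h i 0 = 0" for i using neg by (simp add: h_def)
  \<comment> \<open>The prescribed half sums are 0 or 1 by parity, so corner sums in column k are
    integral; the shift thus preserves the equality constraints there.\<close>
  have hk: "h i k = 0" if "i \<le> k" for i
  proof -
    have "row_sum X a k \<in> \<int>" if "a \<in> {1..i}" for a
    proof -
      have "2 * row_sum X a k = 1 - (-1) ^ (a + 1)"
        using X that \<open>i \<le> k\<close> by (auto simp: quadrant_polytope_def)
      then have "row_sum X a k = (if even a then 1 else 0)" by (auto split: if_splits)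
      then show ?thesis by simp
    qed
    then have int: "corner_sum X i k \<in> \<int>"
      unfolding corner_sum_def by (intro Ints_sum) auto
    have "corner_sum X i k - corner_sum X p q \<notin> \<int>"
    proof
      assume "corner_sum X i k - corner_sum X p q \<in> \<int>"
      from Ints_diff[OF int this] show False using frac by simp
    qed
    then show ?thesis by (simp add: h_def)
  qed
  note D_facts = quadrant_matrix_P_TS[OF n hsym h0 D_def]
    quadrant_matrix_middle[OF n hsym h0 D_def] row_sum_quadrant_matrix[OF n hsym h0 D_def]
  \<comment> \<open>An integral row sum makes its two corner sums congruent modulo 1, so
    \<open>h\<close> agrees on them and their difference in \<open>D\<close> is 0.\<close>
  have change: "row_sum X i j \<notin> \<int>" if "i \<in> {1..k}" "j \<in> {1..k}" "row_sum D i j \<noteq> 0" for i j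
  proof
    assume int: "row_sum X i j \<in> \<int>"
    have "corner_sum X i j - corner_sum X p q
        = row_sum X i j + (corner_sum X (i - 1) j - corner_sum X p q)"
      using row_sum_eq_corner_sum[of i X j] that(1) by simp
    then have "corner_sum X i j - corner_sum X p q \<in> \<int> \<longleftrightarrow>
        corner_sum X (i - 1) j - corner_sum X p q \<in> \<int>"
      using int by (metis Ints_add Ints_diff add_diff_cancel_left')
    then show False
      using that D_facts(3)[of i j] by (simp add: h_def)
  qed
  \<comment> \<open>These are the slacks of the fractional row sums; the extra 1 keeps the set
    nonempty, so that its minimum is a positive step size.\<close>
  define E where "E = insert 1 ((\<lambda>(i, j). min (row_sum X i j) (1 - row_sum X i j)) `
    {(i, j) \<in> {1..k} \<times> {1..k}. row_sum X i j \<notin> \<int>})"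
  have "finite {(i, j) \<in> {1..k} \<times> {1..k}. row_sum X i j \<notin> \<int>}"
    by (rule finite_subset[of _ "{1..k} \<times> {1..k}"]) auto
  then have finE: "finite E" unfolding E_def by blast
  have bnd: "0 \<le> row_sum X i j" "row_sum X i j \<le> 1" if "i \<in> {1..k}" "j \<in> {1..k}" for i j
    using X that by (auto simp: quadrant_polytope_def)
  have posE: "0 < e" if "e \<in> E" for e
  proof -
    have "0 < min (row_sum X i j) (1 - row_sum X i j)"
      if "i \<in> {1..k}" "j \<in> {1..k}" "row_sum X i j \<notin> \<int>" for i j
      using bnd[OF that(1,2)] that(3)
      by (metis Ints_0 Ints_1 diff_gt_0_iff_gt less_eq_real_def min_less_iff_conj)
    then show ?thesis using that unfolding E_def by auto
  qed
  define \<epsilon> where "\<epsilon> = Min E"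
  have "E \<noteq> {}" by (simp add: E_def)
  then have \<epsilon>: "0 < \<epsilon>" using finE posE by (simp add: \<epsilon>_def)
  have \<epsilon>_le: "\<epsilon> \<le> row_sum X i j" "\<epsilon> \<le> 1 - row_sum X i j"
    if "i \<in> {1..k}" "j \<in> {1..k}" "row_sum D i j \<noteq> 0" for i j
  proof -
    have "min (row_sum X i j) (1 - row_sum X i j) \<in> E"
      using that change[OF that] by (auto simp: E_def)
    then have "\<epsilon> \<le> min (row_sum X i j) (1 - row_sum X i j)"
      unfolding \<epsilon>_def by (rule Min_le[OF finE])
    then show "\<epsilon> \<le> row_sum X i j" "\<epsilon> \<le> 1 - row_sum X i j" by auto
  qed
  \<comment> \<open>Stated for both signs of t. Row sums of \<open>D\<close> lie in {0, 1, -1}, so a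
    shift changes a row sum by at most \<epsilon>, which is within both slacks wherever
    \<open>D\<close> acts.\<close>
  have shift: "X + t *\<^sub>R D \<in> quadrant_polytope k" if t: "\<bar>t\<bar> = \<epsilon>" for t
  proof -
    have "X + t *\<^sub>R D \<in> P_TS"
      using X D_facts(1) by (auto simp: quadrant_polytope_def P_TS_def P_VS_def P_DS_def)
    moreover have "row_sum D i k = 0" if "i \<in> {1..k}" for i
      using D_facts(3)[of i k] hk that by auto
    moreover have "0 \<le> row_sum X i j + t * row_sum D i j \<and> row_sum X i j + t * row_sum D i j \<le> 1"
      if ij: "i \<in> {1..k}" "j \<in> {1..k}" for i j
    proof (cases "row_sum D i j = 0")
      case False
      have "row_sum D i j \<in> {0, 1, -1}"
        using D_facts(3)[of i j] ij by (auto simp: h_def)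
      then have "\<bar>t * row_sum D i j\<bar> \<le> \<epsilon>" using t \<epsilon> by auto
      then show ?thesis using \<epsilon>_le[OF ij False] by auto
    qed (use bnd[OF ij] in simp)
    ultimately show ?thesis
      using X D_facts(2) by (auto simp: quadrant_polytope_def)
  qed
  \<comment> \<open>If \<open>D\<close> vanished, \<open>h\<close> would be constant down column q,
    but it is 0 in row 0 and 1 at row p.\<close>
  have "D \<noteq> 0"
  proof
    assume "D = 0"
    then have "row_sum D i q = 0" for i by (simp add: row_sum_def)
    then have "(\<Sum>i=1..p. h i q - h (i - 1) q) = 0"
      using D_facts(3)[of _ q] pq by (intro sum.neutral) auto
    then have "h p q = h 0 q"
      using sum_diff_telescope[of "\<lambda>i. h i q" p] by simp
    then show False using neg by (simp add: h_def)
  qed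
  \<comment> \<open>\<open>X\<close> is the midpoint of two distinct points of the polytope,
    contradicting extremality.\<close>
  then have "X + \<epsilon> *\<^sub>R D \<noteq> X + (- \<epsilon>) *\<^sub>R D"
    using \<epsilon> by (simp add: eq_neg_iff_add_eq_0 flip: scaleR_add_left)
  then have "midpoint (X + \<epsilon> *\<^sub>R D) (X + (- \<epsilon>) *\<^sub>R D) \<in> open_segment (X + \<epsilon> *\<^sub>R D) (X + (- \<epsilon>) *\<^sub>R D)"
    by simp
  moreover have "midpoint (X + \<epsilon> *\<^sub>R D) (X + (- \<epsilon>) *\<^sub>R D) = X"
    by (simp add: midpoint_def flip: scaleR_2)
  ultimately have "X \<in> open_segment (X + \<epsilon> *\<^sub>R D) (X + (- \<epsilon>) *\<^sub>R D)"
    by (simp only:)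
  moreover have "X + \<epsilon> *\<^sub>R D \<in> quadrant_polytope k" "X + (- \<epsilon>) *\<^sub>R D \<in> quadrant_polytope k"
    using \<epsilon> by (auto intro!: shift simp del: scaleR_minus_left)
  ultimately show False
    using ext unfolding extreme_point_of_def by blast
qed

section \<open>From extreme points to the equalities\<close>

lemma quadrant_polytope_subset_P_TSASM:
  assumes n: "CARD('n::{finite,linorder}) = 2 * k + 1"
  shows "quadrant_polytope k \<subseteq> (P_TSASM :: 'n sq_matrix set)"
proof -
  have "is_TSASM X" if ext: "X extreme_point_of quadrant_polytope k" for X :: "'n sq_matrix"
  proof (rule integral_quadrant_polytope_TSASM[OF n])
    show "X \<in> quadrant_polytope k" using ext by (simp add: extreme_point_of_def)
    show "row_sum X i j \<in> \<int>" if "i \<in> {1..k}" "j \<in> {1..k}" for i j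
      using that extreme_point_corner_sum_Ints[OF n ext] row_sum_eq_corner_sum[of i X j]
      by (auto intro!: Ints_diff)
  qed
  \<comment> \<open>By Krein-Milman the left side is the whole quadrant polytope, which is compact
    and convex.\<close>
  then have "convex hull {X. X extreme_point_of quadrant_polytope k} \<subseteq> (P_TSASM :: 'n sq_matrix set)"
    unfolding P_TSASM_def by (intro hull_mono) auto
  then show ?thesis
    using Krein_Milman_Minkowski[OF compact_quadrant_polytope[OF n] convex_quadrant_polytope] by simp
qed

theorem theorem9p5:
  fixes k :: nat
  assumes "k = CARD('n::{finite,linorder}) div 2"
  shows "(P_TSASM :: 'n sq_matrix set) =
           P_ASM \<inter> P_TS \<inter>
           {X. \<forall>i\<in>{1..CARD('n)}. entry X i (k + 1) = (-1) ^ (i + 1) \<and>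
                                  entry X (k + 1) i = (-1) ^ (i + 1)}
       \<and> P_ASM \<inter> P_TS \<inter>
           {X. \<forall>i\<in>{1..CARD('n)}. entry X i (k + 1) = (-1) ^ (i + 1) \<and>
                                  entry X (k + 1) i = (-1) ^ (i + 1)} =
         (P_VSASM :: 'n sq_matrix set) \<inter> P_DS"
proof -
  \<comment> \<open>Both equalities follow from a cycle of three inclusions: \<open>?M\<close> in
    \<open>P_TSASM\<close>, that in \<open>P_VSASM \<inter> P_DS\<close>, and that in
    \<open>?M\<close>.\<close>
  let ?M = "P_ASM \<inter> P_TS \<inter> middle_cross k :: 'n sq_matrix set"
  have "?M \<subseteq> P_TSASM"
  proof
    fix X assume X: "X \<in> ?M"
    have "odd CARD('n)" by (rule odd_card_of_middle_cross[OF X assms])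
    then have n: "CARD('n) = 2 * k + 1" using assms by presburger
    show "X \<in> P_TSASM"
      using X middle_cross_subset_quadrant_polytope[OF n] quadrant_polytope_subset_P_TSASM[OF n]
      by blast
  qed
  moreover have "(P_TSASM :: 'n sq_matrix set) \<subseteq> P_VSASM \<inter> P_DS"
    unfolding P_TSASM_def P_VSASM_def
    by (intro Int_greatest hull_mono hull_minimal convex_P_DS)
      (auto simp: is_TSASM_def is_VSASM_def P_TS_def)
  moreover have "(P_VSASM :: 'n sq_matrix set) \<inter> P_DS \<subseteq> ?M"
  proof
    fix X :: "'n sq_matrix"
    assume X: "X \<in> P_VSASM \<inter> P_DS"
    have "P_VSASM \<subseteq> (P_ASM :: 'n sq_matrix set)"
      unfolding P_ASM_def P_VSASM_def by (intro hull_mono) (auto simp: is_VSASM_def)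
    moreover have "P_VSASM \<subseteq> (P_VS :: 'n sq_matrix set)"
      unfolding P_VSASM_def by (intro hull_minimal convex_P_VS) (auto simp: is_VSASM_def)
    moreover have "P_VSASM \<subseteq> {X :: 'n sq_matrix. \<forall>i\<in>{1..CARD('n)}. entry X i (k + 1) = (-1) ^ (i + 1)}"
      unfolding P_VSASM_def
      by (intro hull_minimal convex_middle_column) (use VSASM_middle_column(2)[OF _ assms] in blast)
    ultimately have "X \<in> P_ASM \<inter> P_TS" and mid: "\<forall>i\<in>{1..CARD('n)}. entry X i (k + 1) = (-1) ^ (i + 1)"
      using X by (auto simp: P_TS_def)
    moreover have "entry X (k + 1) i = entry X i (k + 1)" if "i \<in> {1..CARD('n)}" for i
    proof -
      \<comment> \<open>\<open>P_DS\<close> speaks only about indices up to n. A nonempty hull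
        supplies a VSASM, hence n is odd and k + 1 is in range.\<close>
      have "P_VSASM \<noteq> ({} :: 'n sq_matrix set)" using X by blast
      then obtain Y :: "'n sq_matrix" where "is_VSASM Y"
        unfolding P_VSASM_def convex_hull_eq_empty by blast
      then have "odd CARD('n)" using VSASM_middle_column(1)[OF _ assms that] by blast
      then have "k + 1 \<in> {1..CARD('n)}" using assms by (auto elim: oddE)
      then show ?thesis using X that by (auto simp: P_DS_def)
    qed
    ultimately show "X \<in> ?M" by (auto simp: middle_cross_def)
  qed
  ultimately show ?thesis
    unfolding middle_cross_def by blast
qed

end
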